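(* Let $m\ge 1$ and $n\ge 4$ be integers. Then $\mathrm{Hom}(C_{2m},L_n)$ is homotopy equivalent to the (discrete) space consisting of two points.
   Context: Graphs are finite and undirected (edge sets are symmetric subsets of $V\times V$; loops are allowed). For an integer $k\ge 2$, $C_k$ is the graph with vertex set $\{1,\dots,k\}$, identified with $\mathbb{Z}_k$, and edge set $\{(x,x+1),(x+1,x) : x\in\mathbb{Z}_k\}$; $L_n$ is the graph with vertex set $\{1,\dots,n\}$ and edge set $\{(x,x+1),(x+1,x) : 1\le x\le n-1\}$. For graphs $G,H$, $\mathrm{Hom}(G,H)$ is the polyhedral complex whose cells are indexed by all functions $\eta:V(G)\to 2^{V(H)}\setminus\{\emptyset\}$ such that whenever $(x,y)\in E(G)$, $\tilde x\in\eta(x)$ and $\tilde y\in\eta(y)$, one has $(\tilde x,\tilde y)\in E(H)$; the cell $\eta$ is the product over $x\in V(G)$ of the simplices with vertex sets $\eta(x)$, and its closure consists of all cells $\tilde\eta$ with $\tilde\eta(x)\subseteq\eta(x)$ for all $x\in V(G)$. *)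

theory Defs
  imports "HOL-Analysis.Analysis" "HOL-Number_Theory.Cong" "Graph_Theory.Pair_Digraph"
begin

(* Graphs are finite and undirected, loops allowed, edges being ordered pairs: these are the
   structures satisfying pair_pseudo_graph. *)

definition cycle_graph :: "nat \<Rightarrow> nat pair_pre_digraph" where
  "cycle_graph k = \<lparr> pverts = {1..k},
     parcs = {(x, y). x \<in> {1..k} \<and> y \<in> {1..k} \<and> ([y = x + 1] (mod k) \<or> [x = y + 1] (mod k))} \<rparr>"

definition path_graph :: "nat \<Rightarrow> nat pair_pre_digraph" where
  "path_graph n = \<lparr> pverts = {1..n},
     parcs = {(x, y). x \<in> {1..n} \<and> y \<in> {1..n} \<and> (y = x + 1 \<or> x = y + 1)} \<rparr>"

lemma pair_pseudo_graph_cycle_graph: "pair_pseudo_graph (cycle_graph k)"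
proof
  show "finite (parcs (cycle_graph k))"
    by (rule finite_subset[of _ "{1..k} \<times> {1..k}"]) (auto simp: cycle_graph_def)
qed (auto simp: cycle_graph_def symmetric_def sym_def)

lemma pair_pseudo_graph_path_graph: "pair_pseudo_graph (path_graph n)"
proof
  show "finite (parcs (path_graph n))"
    by (rule finite_subset[of _ "{1..n} \<times> {1..n}"]) (auto simp: path_graph_def)
qed (auto simp: path_graph_def symmetric_def sym_def)

definition hom_cells ::
    "'a pair_pre_digraph \<Rightarrow> 'b pair_pre_digraph \<Rightarrow> ('a \<Rightarrow> 'b set) set" where
  "hom_cells G H =
     {\<eta> \<in> pverts G \<rightarrow>\<^sub>E Pow (pverts H) - {{}}.
        \<forall>x y. (x, y) \<in> parcs G \<longrightarrow> (\<forall>x'\<in>\<eta> x. \<forall>y'\<in>\<eta> y. (x', y') \<in> parcs H)}"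

(* The simplex with vertex set A, in barycentric coordinates; A is meant to be finite. *)

definition simplex_on :: "'b set \<Rightarrow> ('b \<Rightarrow> real) set" where
  "simplex_on A = {t. (\<forall>y. 0 \<le> t y) \<and> (\<forall>y. y \<notin> A \<longrightarrow> t y = 0) \<and> sum t A = 1}"

definition closed_cell :: "'a pair_pre_digraph \<Rightarrow> ('a \<Rightarrow> 'b set) \<Rightarrow> ('a \<Rightarrow> 'b \<Rightarrow> real) set" where
  "closed_cell G \<eta> = (\<Pi>\<^sub>E x\<in>pverts G. simplex_on (\<eta> x))"

(* The complex is realised as a subcomplex of the product over x in V(G) of copies of the simplex
   with vertex set V(H).  The faces of simplex_on A are the sets simplex_on B for nonempty
   B \<subseteq> A, so the incidences between cells are the prescribed ones.  For finite G and H
   there are finitely many cells, and the subspace topology is the cell complex topology. *)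

definition hom_complex ::
    "'a pair_pre_digraph \<Rightarrow> 'b pair_pre_digraph \<Rightarrow> ('a \<Rightarrow> 'b \<Rightarrow> real) topology" where
  "hom_complex G H =
     subtopology (product_topology (\<lambda>x. powertop_real UNIV) (pverts G))
       (\<Union>\<eta>\<in>hom_cells G H. closed_cell G \<eta>)"

end

theory Submission
  imports Defs
begin

text \<open>
  A point of the complex assigns to every vertex of the cycle a probability vector on
  \<open>{1..n}\<close>, and along an edge the supports differ by exactly one. Hence the parity of
  (vertex + value) is constant, which splits the space into two clopen parts. Within one part
  a probability vector is determined by its tail sums \<open>T k\<close>, and along an edge the tail sums of
  the two endpoints, interleaved according to parity, form a sequence \<open>1, \<dots>, 1, \<theta>, 0, \<dots>, 0\<close>
  with at most one fractional entry. Such sequences are closed under pointwise minimum, so each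
  part is a topological meet-semilattice. Taking the minimum with a sequence that rises from the
  bottom element to the top element contracts each part to its bottom element.
\<close>

section \<open>Points of a Hom complex as families of probability vectors\<close>

text \<open>The supports of the vectors \<open>p x\<close> form the smallest candidate for a cell
  containing \<open>p\<close>, so the union of cells turns into a condition on supports
  alone.\<close>

lemma topspace_hom_complex:
  assumes "pair_wf_digraph G" and fin: "finite (pverts H)"
  shows "topspace (hom_complex G H) =
    {p \<in> pverts G \<rightarrow>\<^sub>E simplex_on (pverts H).
       \<forall>x y. (x, y) \<in> parcs G \<longrightarrow> (\<forall>a b. p x a \<noteq> 0 \<longrightarrow> p y b \<noteq> 0 \<longrightarrow> (a, b) \<in> parcs H)}"
    (is "?X = ?P")
proof -
  interpret pair_wf_digraph G by fact
  have "?X = (\<Union>\<eta>\<in>hom_cells G H. closed_cell G \<eta>)"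
    unfolding hom_complex_def topspace_subtopology
    by (auto simp: closed_cell_def PiE_def)
  also have "\<dots> = ?P"
  proof (intro equalityI subsetI)
    fix p assume "p \<in> (\<Union>\<eta>\<in>hom_cells G H. closed_cell G \<eta>)"
    then obtain \<eta> where \<eta>: "\<eta> \<in> hom_cells G H" and p: "p \<in> closed_cell G \<eta>" by blast
    have sub: "\<eta> x \<subseteq> pverts H" if "x \<in> pverts G" for x
      using \<eta> that by (auto simp: hom_cells_def)
    have mem: "p x \<in> simplex_on (\<eta> x)" if "x \<in> pverts G" for x
      using p that by (auto simp: closed_cell_def)
    have supp: "a \<in> \<eta> x" if "x \<in> pverts G" "p x a \<noteq> 0" for x a
      using mem[OF that(1)] that(2) by (auto simp: simplex_on_def)
    have "p x \<in> simplex_on (pverts H)" if x: "x \<in> pverts G" for x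
    proof -
      have "sum (p x) (pverts H) = sum (p x) (\<eta> x)"
        by (rule sum.mono_neutral_right) (use fin sub[OF x] supp[OF x] in auto)
      then show ?thesis using mem[OF x] sub[OF x] by (auto simp: simplex_on_def)
    qed
    moreover have "(a, b) \<in> parcs H" if "(x, y) \<in> parcs G" "p x a \<noteq> 0" "p y b \<noteq> 0" for x y a b
      using \<eta> that supp[of x a] supp[of y b] in_arcsD1[OF that(1)] in_arcsD2[OF that(1)]
      by (auto simp: hom_cells_def)
    ultimately show "p \<in> ?P" using p by (auto simp: closed_cell_def PiE_def)
  next
    fix p assume p: "p \<in> ?P"
    define \<eta> where "\<eta> = (\<lambda>x\<in>pverts G. {a. p x a \<noteq> 0})"
    have mem: "p x \<in> simplex_on (pverts H)" if "x \<in> pverts G" for x using p that by auto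
    have sub: "\<eta> x \<subseteq> pverts H" if "x \<in> pverts G" for x
      using mem[OF that] that by (auto simp: \<eta>_def simplex_on_def)
    have ne: "\<eta> x \<noteq> {}" if "x \<in> pverts G" for x
    proof
      assume "\<eta> x = {}"
      then have "sum (p x) (pverts H) = 0" using that by (auto simp: \<eta>_def)
      then show False using mem[OF that] by (simp add: simplex_on_def)
    qed
    have "\<eta> \<in> pverts G \<rightarrow>\<^sub>E Pow (pverts H) - {{}}"
      using sub ne by (auto simp: \<eta>_def)
    moreover have "\<forall>x y. (x, y) \<in> parcs G \<longrightarrow> (\<forall>a\<in>\<eta> x. \<forall>b\<in>\<eta> y. (a, b) \<in> parcs H)"
      using p in_arcsD1 in_arcsD2 by (auto simp: \<eta>_def)
    ultimately have "\<eta> \<in> hom_cells G H" by (simp add: hom_cells_def)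
    moreover have "p x \<in> simplex_on (\<eta> x)" if x: "x \<in> pverts G" for x
    proof -
      have "sum (p x) (pverts H) = sum (p x) (\<eta> x)"
        by (rule sum.mono_neutral_right) (use fin sub[OF x] x in \<open>auto simp: \<eta>_def\<close>)
      then show ?thesis using mem[OF x] x by (auto simp: simplex_on_def \<eta>_def)
    qed
    then have "p \<in> closed_cell G \<eta>" using p by (auto simp: closed_cell_def)
    ultimately show "p \<in> (\<Union>\<eta>\<in>hom_cells G H. closed_cell G \<eta>)" by blast
  qed
  finally show ?thesis .
qed

section \<open>Chains and the pairs of probability vectors they encode\<close>

text \<open>Abstract form of the interleaved tail sums along one edge. The two boundary values give
  both layers total mass 1 inside \<open>{1..n}\<close>; monotonicity follows from the bounds and
  the second clause.\<close>

definition chain :: "nat \<Rightarrow> (nat \<Rightarrow> real) \<Rightarrow> bool" where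
  "chain n M \<longleftrightarrow> (\<forall>k. 0 \<le> M k \<and> M k \<le> 1) \<and> (\<forall>k. M k < 1 \<longrightarrow> M (Suc k) = 0) \<and>
     M 2 = 1 \<and> M (Suc n) = 0"

text \<open>Recovers a probability vector supported on the parity class \<open>c\<close> from its tail sums: since these
  do not change across indices of the wrong parity, only the entries of \<open>M\<close> in class \<open>c\<close> matter.\<close>

definition layer :: "bool \<Rightarrow> (nat \<Rightarrow> real) \<Rightarrow> nat \<Rightarrow> real" where
  "layer c M a = (if even a = c then M a - M (Suc (Suc a)) else 0)"

definition tail_sum :: "nat \<Rightarrow> (nat \<Rightarrow> real) \<Rightarrow> nat \<Rightarrow> real" where
  "tail_sum n t k = (\<Sum>a=k..n. t a)"

text \<open>A path of chains for \<open>s\<close> between 3 and \<open>real n + 1\<close>: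
  \<open>ramp 3\<close> is 1 up to index 2 and 0 afterwards, while \<open>ramp (real n + 1)\<close>
  is 1 up to index \<open>n\<close> and 0 afterwards.\<close>

definition ramp :: "real \<Rightarrow> nat \<Rightarrow> real" where
  "ramp s k = max 0 (min 1 (s - real k))"

text \<open>If the minimum is below 1 at \<open>k\<close>, one of the two chains is below 1 there,
  hence 0 at \<open>Suc k\<close>, where the other is nonnegative.\<close>

lemma chain_min: "chain n M \<Longrightarrow> chain n N \<Longrightarrow> chain n (\<lambda>k. min (M k) (N k))"
  unfolding chain_def by (auto simp: min_less_iff_disj min_absorb1 min_absorb2 min.coboundedI1)

lemma chain_ramp: "3 \<le> s \<Longrightarrow> s \<le> real n + 1 \<Longrightarrow> chain n (ramp s)"
  unfolding chain_def ramp_def by (auto simp: max_def min_def)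

lemma chain_Suc_le: "chain n M \<Longrightarrow> M (Suc k) \<le> M k"
  unfolding chain_def by (metis antisym_conv2 order_refl)

lemma chain_antimono: "chain n M \<Longrightarrow> j \<le> k \<Longrightarrow> M k \<le> M j"
  using lift_Suc_antimono_le[of M j k] chain_Suc_le by blast

lemma chain_eq_0: assumes "chain n M" "M j < 1" "j < k" shows "M k = 0"
proof -
  have "M (Suc j) = 0" "0 \<le> M k" using assms unfolding chain_def by auto
  with chain_antimono[OF assms(1), of "Suc j" k] assms(3) show ?thesis by simp
qed

lemma layer_cong: "(\<And>k. even k = c \<Longrightarrow> M k = N k) \<Longrightarrow> layer c M = layer c N"
  by (auto simp: layer_def)

lemma layer_simplex:
  assumes "chain n M"
  shows "layer c M \<in> simplex_on {1..n}"
proof -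
  have 0: "layer c M a = 0" if "a \<notin> {1..n}" for a
  proof (cases "a = 0")
    case True
    have "M 0 = 1" "M 2 = 1"
      using chain_antimono[OF assms, of 0 2] assms unfolding chain_def
      by (auto intro!: antisym)
    then show ?thesis using True by (simp add: layer_def numeral_2_eq_2)
  next
    case False
    then have "Suc n \<le> a" using that by auto
    moreover have "M (Suc n) = 0" "\<And>k. 0 \<le> M k" using assms unfolding chain_def by auto
    ultimately have "M a = 0" "M (Suc (Suc a)) = 0"
      using chain_antimono[OF assms, of "Suc n"] by (metis antisym le_SucI)+
    then show ?thesis by (simp add: layer_def)
  qed
  \<comment> \<open>\<open>V k\<close> is \<open>M\<close> at the first index from \<open>k\<close>
    on that lies in class \<open>c\<close>. Its consecutive differences are the values of the layer,
    so the sum telescopes.\<close>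
  define V where "V k = (if even k = c then M k else M (Suc k))" for k
  have M1: "M 2 = 1" "M 1 = 1" "M (Suc n) = 0" "M (Suc (Suc n)) = 0"
    using assms chain_antimono[OF assms, of 1 2] chain_antimono[OF assms, of "Suc n" "Suc (Suc n)"]
    unfolding chain_def by (auto intro: antisym)
  have "sum (layer c M) {1..n} = (\<Sum>a=1..n. V a - V (Suc a))"
    by (rule sum.cong) (auto simp: layer_def V_def)
  also have "\<dots> = V 1 - V (Suc n)"
    by (induction n) auto
  also have "\<dots> = 1"
    using M1 by (auto simp: V_def numeral_2_eq_2)
  finally have "sum (layer c M) {1..n} = 1" .
  moreover have "0 \<le> layer c M a" for a
    using chain_antimono[OF assms, of a "Suc (Suc a)"] by (auto simp: layer_def)
  ultimately show ?thesis using 0 by (auto simp: simplex_on_def)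
qed

text \<open>A drop between \<open>i\<close> and \<open>i + 2\<close> makes \<open>M\<close> less
  than 1 at \<open>i + 2\<close>, hence 0 beyond, so no drop starts at \<open>i + 3\<close> or
  later. Used both ways this bounds the distance of \<open>a\<close> and \<open>b\<close> by 2, and
  their opposite parity leaves only 1.\<close>

lemma layer_adjacent:
  assumes "chain n M" "layer c M a \<noteq> 0" "layer (\<not> c) M b \<noteq> 0"
  shows "b = Suc a \<or> a = Suc b"
proof -
  have le: "j < i + 3" if "M i \<noteq> M (Suc (Suc i))" "M j \<noteq> M (Suc (Suc j))" for i j
  proof (rule ccontr)
    assume "\<not> j < i + 3"
    moreover have "M (Suc (Suc i)) < 1"
      using that(1) chain_antimono[OF assms(1), of i "Suc (Suc i)"] assms(1)
      unfolding chain_def by (metis le_SucI less_eq_real_def order_less_le_trans order_refl)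
    ultimately have "M j = 0" "M (Suc (Suc j)) = 0"
      using chain_eq_0[OF assms(1)] by auto
    then show False using that by simp
  qed
  have "even a = c" "even b \<noteq> c" "M a \<noteq> M (Suc (Suc a))" "M b \<noteq> M (Suc (Suc b))"
    using assms(2,3) by (auto simp: layer_def split: if_splits)
  then have "a < b + 3" "b < a + 3" "a \<noteq> b" "a \<noteq> b + 2" "b \<noteq> a + 2" using le by auto
  then show ?thesis by linarith
qed

lemma tail_Suc: "t \<in> simplex_on {1..n} \<Longrightarrow> tail_sum n t k = t k + tail_sum n t (Suc k)"
  by (cases "k \<le> n") (auto simp: tail_sum_def sum.atLeast_Suc_atMost simplex_on_def)

text \<open>For \<open>a\<close> in class \<open>c\<close> the tail sums drop by
  \<open>t a + t (Suc a)\<close> between \<open>a\<close> and \<open>a + 2\<close>, and the second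
  term vanishes by parity.\<close>

lemma layer_tail:
  assumes "t \<in> simplex_on {1..n}" "\<And>a. t a \<noteq> 0 \<Longrightarrow> even a = c"
  shows "layer c (tail_sum n t) = t"
proof
  fix a show "layer c (tail_sum n t) a = t a"
    using tail_Suc[OF assms(1), of a] tail_Suc[OF assms(1), of "Suc a"] assms(2)[of a] assms(2)[of "Suc a"]
    by (auto simp: layer_def)
qed

lemma tail_bounds:
  assumes "t \<in> simplex_on {1..n}"
  shows "0 \<le> tail_sum n t k" "tail_sum n t k \<le> 1" "tail_sum n t (Suc n) = 0" "k \<le> 1 \<Longrightarrow> tail_sum n t k = 1"
proof -
  have t: "\<And>a. 0 \<le> t a" "t 0 = 0" "sum t {1..n} = 1" using assms by (auto simp: simplex_on_def)
  have 0: "sum t {0..n} = 1" using t by (simp add: sum.atLeast_Suc_atMost)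
  show "0 \<le> tail_sum n t k" "tail_sum n t (Suc n) = 0" using t by (auto simp: tail_sum_def intro: sum_nonneg)
  have "sum t {k..n} \<le> sum t {0..n}" by (rule sum_mono2) (auto simp: t)
  then show "tail_sum n t k \<le> 1" using 0 by (simp add: tail_sum_def)
  assume "k \<le> 1"
  then consider "k = 0" | "k = 1" by linarith
  then show "tail_sum n t k = 1" using 0 t by cases (auto simp: tail_sum_def)
qed

lemma tail_less_1:
  assumes "t \<in> simplex_on {1..n}" "tail_sum n t k < 1"
  obtains a where "a < k" "t a \<noteq> 0"
proof -
  have "\<exists>a<k. t a \<noteq> 0"
    using assms(2)
  proof (induction k)
    case 0 then show ?case using tail_bounds(4)[OF assms(1), of 0] by simp
  next
    case (Suc k)
    then show ?case using tail_Suc[OF assms(1), of k] by (metis add_0 less_Suc_eq)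
  qed
  with that show ?thesis by blast
qed

text \<open>A tail below 1 at \<open>k\<close> means that one vector has mass at some
  \<open>a < k\<close>. Adjacency keeps the support of the other at or below \<open>k\<close>, so
  its tail from \<open>Suc k\<close> is 0. Interleaving lets \<open>k\<close> and
  \<open>Suc k\<close> refer to different vectors, which turns this into the chain
  condition.\<close>

lemma chain_tails:
  assumes t: "t \<in> simplex_on {1..n}" "\<And>a. t a \<noteq> 0 \<Longrightarrow> even a = c"
    and u: "u \<in> simplex_on {1..n}" "\<And>a. u a \<noteq> 0 \<Longrightarrow> even a \<noteq> c"
    and adj: "\<And>a b. t a \<noteq> 0 \<Longrightarrow> u b \<noteq> 0 \<Longrightarrow> b = Suc a \<or> a = Suc b"
  shows "chain n (\<lambda>k. if even k = c then tail_sum n t k else tail_sum n u k)"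
proof -
  have drop: "tail_sum n v (Suc k) = 0"
    if w: "w \<in> simplex_on {1..n}" "tail_sum n w k < 1"
      and adj': "\<And>a b. w a \<noteq> 0 \<Longrightarrow> v b \<noteq> 0 \<Longrightarrow> b = Suc a \<or> a = Suc b" for v w k
  proof -
    obtain a where a: "a < k" "w a \<noteq> 0" using tail_less_1[OF w] .
    have "v b = 0" if "b \<ge> Suc k" for b using adj'[of a b] a that by force
    then show ?thesis by (auto simp: tail_sum_def)
  qed
  \<comment> \<open>Entry 2 is the tail of whichever vector lives on even values, and that vector
    has no mass at 1.\<close>
  have 2: "tail_sum n v 2 = 1" if "v \<in> simplex_on {1..n}" "v 1 = 0" for v
    using tail_Suc[OF that(1), of 1] tail_bounds(4)[OF that(1), of 1] that(2)
    by (simp add: numeral_2_eq_2)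
  show ?thesis
    unfolding chain_def
    using tail_bounds[OF t(1)] tail_bounds[OF u(1)] 2[OF t(1)] 2[OF u(1)] t(2)[of 1] u(2)[of 1]
      drop[OF t(1), of _ u] drop[OF u(1), of _ t] adj
    by (auto; metis)
qed

lemma chain_bounds:
  assumes "chain n M"
  shows "ramp 3 k \<le> M k" "M k \<le> ramp (real n + 1) k"
proof -
  have M: "0 \<le> M k" "M k \<le> 1" "M 2 = 1" "M (Suc n) = 0" using assms by (auto simp: chain_def)
  show "ramp 3 k \<le> M k"
    using chain_antimono[OF assms, of k 2] M by (cases "k \<le> 2") (auto simp: ramp_def)
  show "M k \<le> ramp (real n + 1) k"
    using chain_antimono[OF assms, of "Suc n" k] M by (cases "k \<le> n") (auto simp: ramp_def)
qed

section \<open>Even cycles, parity and the deformation formula\<close>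

lemma cycle_graph_even_arcD:
  assumes "(x, y) \<in> parcs (cycle_graph (2 * m))"
  shows "x \<in> {1..2*m}" "y \<in> {1..2*m}" "even y \<noteq> even x"
proof -
  show "x \<in> {1..2*m}" "y \<in> {1..2*m}" using assms by (auto simp: cycle_graph_def)
  \<comment> \<open>Congruence modulo the even number \<open>2 * m\<close> descends to congruence
    modulo 2.\<close>
  have "[y = x + 1] (mod 2) \<or> [x = y + 1] (mod 2)"
    using assms cong_dvd_modulus_nat[of _ _ "2 * m" 2] by (auto simp: cycle_graph_def)
  then show "even y \<noteq> even x"
    by (auto simp: cong_def even_iff_mod_2_eq_zero mod_Suc split: if_splits)
qed

text \<open>Later facts are proved arc by arc; a neighbour transfers them to a single vertex. The
  last vertex \<open>2 * m\<close> wraps around to 1.\<close>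

lemma cycle_graph_has_neighbour:
  assumes "x \<in> {1..2*m}"
  obtains y where "(x, y) \<in> parcs (cycle_graph (2 * m))"
proof (cases "x < 2 * m")
  case True
  then have "(x, x + 1) \<in> parcs (cycle_graph (2 * m))" using assms by (auto simp: cycle_graph_def)
  then show ?thesis using that by blast
next
  case False
  then have "(x, 1) \<in> parcs (cycle_graph (2 * m))" using assms
    by (auto simp: cycle_graph_def cong_def mod_Suc)
  then show ?thesis using that by blast
qed

text \<open>On the complex this takes only the values 0 and 1; it is a continuous indicator of the
  parity class, which lets one formula define the contraction on both parts.\<close>

definition odd_mass :: "nat \<Rightarrow> (nat \<Rightarrow> nat \<Rightarrow> real) \<Rightarrow> real" where
  "odd_mass n p = (\<Sum>a\<in>{a \<in> {1..n}. odd a}. p 1 a)"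

text \<open>The layers of \<open>ramp 3\<close> are point masses, at 2 if \<open>even x = e\<close>
  and at 1 otherwise. This is the vertex of the complex that folds the cycle onto the edge between 1
  and 2.\<close>

definition bottom :: "nat \<Rightarrow> bool \<Rightarrow> nat \<Rightarrow> nat \<Rightarrow> real" where
  "bottom m e = (\<lambda>x\<in>{1..2*m}. layer (even x = e) (ramp 3))"

text \<open>On the complex the first factor is 1 for values \<open>a\<close> of the parity that
  belongs to \<open>x\<close> and 0 for the others, so this is a layer of the minimum with
  \<open>ramp s\<close>. It is written in coordinates of \<open>p\<close> alone to make continuity
  visible.\<close>

definition raise :: "nat \<Rightarrow> nat \<Rightarrow> real \<Rightarrow> (nat \<Rightarrow> nat \<Rightarrow> real) \<Rightarrow> nat \<Rightarrow> nat \<Rightarrow> real" where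
  "raise m n s p = (\<lambda>x\<in>{1..2*m}. \<lambda>a.
     (if even (x + a) then odd_mass n p else 1 - odd_mass n p) *
     (min (tail_sum n (p x) a) (ramp s a) -
      min (tail_sum n (p x) (Suc (Suc a))) (ramp s (Suc (Suc a)))))"

abbreviation hom_cycle_path :: "nat \<Rightarrow> nat \<Rightarrow> (nat \<Rightarrow> nat \<Rightarrow> real) topology" where
  "hom_cycle_path m n \<equiv> hom_complex (cycle_graph (2 * m)) (path_graph n)"

text \<open>The flag \<open>e\<close> tells whether vertex plus value is even.\<close>

definition has_parity :: "nat \<Rightarrow> bool \<Rightarrow> (nat \<Rightarrow> nat \<Rightarrow> real) \<Rightarrow> bool" where
  "has_parity m e p \<longleftrightarrow> (\<forall>x\<in>{1..2*m}. \<forall>a. p x a \<noteq> 0 \<longrightarrow> even a = (even x = e))"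

section \<open>Membership in the complex and the effect of the deformation\<close>

lemma topspace_hom_cycle_path:
  "topspace (hom_cycle_path m n) =
    {p \<in> {1..2*m} \<rightarrow>\<^sub>E simplex_on {1..n}. \<forall>x y. (x, y) \<in> parcs (cycle_graph (2 * m)) \<longrightarrow>
       (\<forall>a b. p x a \<noteq> 0 \<longrightarrow> p y b \<noteq> 0 \<longrightarrow> b = Suc a \<or> a = Suc b)}"
proof -
  interpret pair_pseudo_graph "cycle_graph (2 * m)" by (rule pair_pseudo_graph_cycle_graph)
  have V: "pverts (cycle_graph (2 * m)) = {1..2*m}" "pverts (path_graph n) = {1..n}"
    by (auto simp: cycle_graph_def path_graph_def)
  have finite_path: "finite (pverts (path_graph n))" by (simp add: V)
  have E: "(a, b) \<in> parcs (path_graph n) \<longleftrightarrow> a \<in> {1..n} \<and> b \<in> {1..n} \<and> (b = Suc a \<or> a = Suc b)" for a b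
    by (auto simp: path_graph_def)
  have supp: "p x a \<noteq> 0 \<longrightarrow> p y b \<noteq> 0 \<longrightarrow> a \<in> {1..n} \<and> b \<in> {1..n}"
    if p: "p \<in> {1..2*m} \<rightarrow>\<^sub>E simplex_on {1..n}" and xy: "(x, y) \<in> parcs (cycle_graph (2 * m))"
    for p :: "nat \<Rightarrow> nat \<Rightarrow> real" and x y a b
    using PiE_mem[OF p cycle_graph_even_arcD(1)[OF xy]] PiE_mem[OF p cycle_graph_even_arcD(2)[OF xy]]
    unfolding simplex_on_def by blast
  show ?thesis
    unfolding topspace_hom_complex[OF pair_wf_digraph_axioms finite_path, unfolded V] E
    by (intro Collect_cong conj_cong refl all_cong1 imp_cong) (use supp in blast)
qed

text \<open>Adjacency is tested one arc at a time, so the chain may change from arc to arc while the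
  flag \<open>e\<close> is shared by the whole cycle.\<close>

lemma layers_in_hom_cycle_path:
  assumes q: "q \<in> extensional {1..2*m}"
    and M: "\<And>x y. (x, y) \<in> parcs (cycle_graph (2 * m)) \<Longrightarrow>
      \<exists>M. chain n M \<and> q x = layer (even x = e) M \<and> q y = layer (even y = e) M"
  shows "q \<in> topspace (hom_cycle_path m n)"
proof -
  have "q x \<in> simplex_on {1..n}" if "x \<in> {1..2*m}" for x
    using cycle_graph_has_neighbour[OF that] M layer_simplex by metis
  moreover have "b = Suc a \<or> a = Suc b"
    if "(x, y) \<in> parcs (cycle_graph (2 * m))" "q x a \<noteq> 0" "q y b \<noteq> 0" for x y a b
  proof -
    obtain M where "chain n M" "q x = layer (even x = e) M" "q y = layer (even y = e) M"
      using M \<open>(x, y) \<in> parcs _\<close> by blast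
    moreover have "(even y = e) = (\<not> (even x = e))" using cycle_graph_even_arcD(3)[OF that(1)] by auto
    ultimately show ?thesis using layer_adjacent[of n M "even x = e" a b] that(2,3) by simp
  qed
  ultimately show ?thesis
    unfolding topspace_hom_cycle_path using q by (auto simp: PiE_def)
qed

lemma bottom_in_hom_cycle_path: "n \<ge> 2 \<Longrightarrow> bottom m e \<in> topspace (hom_cycle_path m n)"
  using cycle_graph_even_arcD(1,2)[of _ _ m] chain_ramp[of 3 n]
  by (intro layers_in_hom_cycle_path[where e = e]) (auto simp: bottom_def)

lemma has_parity_bottom: "has_parity m e (bottom m e)"
  by (auto simp: has_parity_def bottom_def layer_def)

lemma simplex_on_nonzero: "t \<in> simplex_on A \<Longrightarrow> \<exists>a. t a \<noteq> 0"
  by (rule ccontr) (auto simp: simplex_on_def)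

text \<open>Along the walk from 1 to \<open>2 * m\<close> each arc flips the parity of the values
  together with that of the vertex.\<close>

lemma has_parity_exists:
  assumes m: "m \<ge> 1" and p: "p \<in> topspace (hom_cycle_path m n)"
  shows "\<exists>e. has_parity m e p"
proof -
  have nz: "\<exists>a. p x a \<noteq> 0" if "x \<in> {1..2*m}" for x
    using p that simplex_on_nonzero unfolding topspace_hom_cycle_path by blast
  have adj: "even b \<noteq> even a" if "Suc x \<in> {1..2*m}" "x \<ge> 1" "p x a \<noteq> 0" "p (Suc x) b \<noteq> 0" for x a b
  proof -
    have "(x, Suc x) \<in> parcs (cycle_graph (2 * m))" using that by (auto simp: cycle_graph_def)
    then have "b = Suc a \<or> a = Suc b" using p that(3,4) unfolding topspace_hom_cycle_path by blast
    then show ?thesis by auto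
  qed
  \<comment> \<open>Vertex 2 is even, so the flag is just the parity of a value in its support; it
    is also the neighbour used in the base case at vertex 1.\<close>
  obtain b where b: "p 2 b \<noteq> 0" using nz[of 2] m by auto
  have "\<forall>a. p x a \<noteq> 0 \<longrightarrow> even a = (even x = even b)" if "1 \<le> x" "x \<le> 2 * m" for x
    using that
  proof (induction x rule: dec_induct)
    case base
    then show ?case using adj[of 1 _ b] b m by (auto simp: numeral_2_eq_2)
  next
    case (step x)
    obtain a where "p x a \<noteq> 0" using nz[of x] step by auto
    then show ?case using adj[of x a] step by auto
  qed
  then have "has_parity m (even b) p" unfolding has_parity_def by (meson atLeastAtMost_iff)
  then show ?thesis ..
qed

lemma odd_mass_eq:
  assumes m: "m \<ge> 1" and p: "p \<in> topspace (hom_cycle_path m n)" and e: "has_parity m e p"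
  shows "odd_mass n p = of_bool e"
proof -
  have e1: "odd a = e" if "p 1 a \<noteq> 0" for a
    using e m that unfolding has_parity_def by fastforce
  have "p 1 \<in> simplex_on {1..n}" using p m unfolding topspace_hom_cycle_path by auto
  then have 1: "sum (p 1) {1..n} = 1" by (simp add: simplex_on_def)
  show ?thesis
  proof (cases e)
    case True
    have "odd_mass n p = sum (p 1) {1..n}"
      unfolding odd_mass_def by (rule sum.mono_neutral_left) (use e1 True in auto)
    then show ?thesis using 1 True by simp
  next
    case False
    then have "p 1 a = 0" if "odd a" for a using e1 that by blast
    then show ?thesis using False by (simp add: odd_mass_def)
  qed
qed

text \<open>\<open>M\<close> interleaves the tail sums of \<open>p x\<close> and \<open>p y\<close>.
  It is obtained before \<open>s\<close>, so one chain describes the whole deformation at both ends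
  of the arc.\<close>

lemma raise_eq_layer:
  assumes m: "m \<ge> 1" and p: "p \<in> topspace (hom_cycle_path m n)" and e: "has_parity m e p"
    and xy: "(x, y) \<in> parcs (cycle_graph (2 * m))"
  obtains M where "chain n M" "p x = layer (even x = e) M"
    "\<And>s z. z \<in> {x, y} \<Longrightarrow> raise m n s p z = layer (even z = e) (\<lambda>k. min (M k) (ramp s k))"
proof -
  note xy' = cycle_graph_even_arcD[OF xy]
  define M where "M k = (if even k = (even x = e) then tail_sum n (p x) k else tail_sum n (p y) k)" for k
  have px: "p x \<in> simplex_on {1..n}" "p y \<in> simplex_on {1..n}"
    using p xy' unfolding topspace_hom_cycle_path by auto
  have parx: "\<And>a. p x a \<noteq> 0 \<Longrightarrow> even a = (even x = e)"
    and pary: "\<And>a. p y a \<noteq> 0 \<Longrightarrow> even a \<noteq> (even x = e)"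
    using e xy' unfolding has_parity_def by blast+
  have "chain n M"
    unfolding M_def using p xy
    by (intro chain_tails px parx pary) (auto simp: topspace_hom_cycle_path)
  moreover have "p x = layer (even x = e) M"
    using layer_tail[OF px(1) parx] layer_cong[of "even x = e" "tail_sum n (p x)" M]
    by (simp add: M_def)
  moreover have "raise m n s p z = layer (even z = e) (\<lambda>k. min (M k) (ramp s k))" if "z \<in> {x, y}" for s z
    using that xy' odd_mass_eq[OF m p e] by (auto simp: raise_def layer_def M_def fun_eq_iff)
  ultimately show ?thesis using that by blast
qed

lemma raise_in_hom_cycle_path:
  assumes m: "m \<ge> 1" and p: "p \<in> topspace (hom_cycle_path m n)" and s: "3 \<le> s" "s \<le> real n + 1"
  shows "raise m n s p \<in> topspace (hom_cycle_path m n)"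
proof -
  obtain e where e: "has_parity m e p" using has_parity_exists[OF m p] by blast
  show ?thesis
  proof (rule layers_in_hom_cycle_path[where e = e])
    fix x y assume "(x, y) \<in> parcs (cycle_graph (2 * m))"
    from raise_eq_layer[OF m p e this] chain_min[OF _ chain_ramp[OF s]]
    show "\<exists>M. chain n M \<and> raise m n s p x = layer (even x = e) M \<and> raise m n s p y = layer (even y = e) M"
      by (metis insertCI)
  qed (simp add: raise_def)
qed

text \<open>By \<open>chain_bounds\<close> every chain lies between the two extreme ramps, so the
  minimum is the ramp itself at one end and the given chain at the other.\<close>

lemma raise_ends:
  assumes m: "m \<ge> 1" and p: "p \<in> topspace (hom_cycle_path m n)" and e: "has_parity m e p"
  shows "raise m n 3 p = bottom m e" "raise m n (real n + 1) p = p"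
proof -
  have "raise m n 3 p x = bottom m e x \<and> raise m n (real n + 1) p x = p x" for x
  proof (cases "x \<in> {1..2*m}")
    case True
    then obtain y where "(x, y) \<in> parcs (cycle_graph (2 * m))" by (rule cycle_graph_has_neighbour)
    then obtain M where M: "chain n M" "p x = layer (even x = e) M"
      "\<And>s. raise m n s p x = layer (even x = e) (\<lambda>k. min (M k) (ramp s k))"
      using raise_eq_layer[OF m p e] by (metis insertCI)
    then show ?thesis using True chain_bounds[OF M(1)] by (simp add: bottom_def min_absorb1 min_absorb2)
  next
    case False
    moreover have "p \<in> extensional {1..2*m}" using p by (auto simp: topspace_hom_cycle_path PiE_def)
    ultimately show ?thesis by (auto simp: raise_def bottom_def extensional_def)
  qed
  then show "raise m n 3 p = bottom m e" "raise m n (real n + 1) p = p" by auto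
qed

section \<open>Continuity of the deformation and the homotopy equivalence\<close>

lemma continuous_map_coordinate:
  assumes "x \<in> {1..2*m}"
  shows "continuous_map (hom_cycle_path m n) euclideanreal (\<lambda>p. p x a)"
proof -
  let ?P = "product_topology (\<lambda>x. powertop_real UNIV) {1..2*m}"
  have "continuous_map ?P (powertop_real UNIV) (\<lambda>p :: nat \<Rightarrow> nat \<Rightarrow> real. p x)"
    using assms by (rule continuous_map_product_projection)
  then have "continuous_map ?P euclideanreal (\<lambda>p :: nat \<Rightarrow> nat \<Rightarrow> real. p x a)"
    unfolding continuous_map_componentwise_UNIV by blast
  then show ?thesis
    unfolding hom_complex_def by (simp add: cycle_graph_def continuous_map_from_subtopology)
qed

lemma continuous_map_odd_mass:
  "m \<ge> 1 \<Longrightarrow> continuous_map (hom_cycle_path m n) euclideanreal (odd_mass n)"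
  unfolding odd_mass_def by (intro continuous_map_sum continuous_map_coordinate) auto

text \<open>The ramp parameter runs from 3 at \<open>t = 0\<close> to \<open>real n + 1\<close> at
  \<open>t = 1\<close>. As the complex has the subspace topology of a product, it suffices that each
  coordinate is continuous and that the values stay in the complex.\<close>

lemma continuous_map_raise:
  assumes m: "m \<ge> 1" and n: "n \<ge> 2"
  shows "continuous_map (prod_topology (top_of_set {0..1}) (hom_cycle_path m n)) (hom_cycle_path m n)
     (\<lambda>(t, p). raise m n (3 + t * (real n - 2)) p)"
    (is "continuous_map ?T ?X ?h")
proof -
  have fst: "continuous_map ?T euclideanreal fst"
    by (metis continuous_map_fst continuous_map_in_subtopology)
  have snd: "continuous_map ?T euclideanreal (\<lambda>z. f (snd z))" if "continuous_map ?X euclideanreal f" for f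
    using continuous_map_compose[OF continuous_map_snd that] by (simp add: o_def)
  have ramp: "continuous_map ?T euclideanreal (\<lambda>z. ramp (3 + fst z * (real n - 2)) k)" for k
    unfolding ramp_def using fst
    by (intro continuous_intros) auto
  have tail: "continuous_map ?T euclideanreal (\<lambda>z. tail_sum n (snd z x) k)" if "x \<in> {1..2*m}" for x k
    unfolding tail_sum_def using that
    by (intro snd[of "\<lambda>p. sum (p x) {k..n}"] continuous_map_sum continuous_map_coordinate) auto
  have "continuous_map ?T (powertop_real UNIV) (\<lambda>z. ?h z x)" if x: "x \<in> {1..2*m}" for x
    unfolding continuous_map_componentwise_UNIV
  proof
    fix a
    show "continuous_map ?T euclideanreal (\<lambda>z. ?h z x a)"
      using x unfolding raise_def case_prod_beta
      by (cases "even (x + a)")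
         (auto intro!: continuous_map_real_mult continuous_map_diff continuous_map_real_min ramp tail
            snd[OF continuous_map_odd_mass[OF m]])
  qed
  then have "continuous_map ?T (product_topology (\<lambda>x. powertop_real UNIV) {1..2*m}) ?h"
    by (auto simp: continuous_map_componentwise raise_def)
  moreover have "?h z \<in> topspace ?X" if "z \<in> topspace ?T" for z
  proof -
    obtain t p where "z = (t, p)" by (cases z)
    then have z: "z = (t, p)" "0 \<le> t" "t \<le> 1" "p \<in> topspace ?X" using that by auto
    have "t * (real n - 2) \<le> 1 * (real n - 2)" using z n by (intro mult_right_mono) auto
    then show ?thesis using raise_in_hom_cycle_path[OF m z(4), of "3 + t * (real n - 2)"] z n by auto
  qed
  ultimately show ?thesis
    unfolding hom_complex_def continuous_map_in_subtopology
    by (auto simp: cycle_graph_def hom_complex_def)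
qed

theorem theorem7p3:
  fixes m n :: nat
  assumes "m \<ge> 1" and "n \<ge> 4"
  shows "hom_complex (cycle_graph (2 * m)) (path_graph n)
           homotopy_equivalent_space discrete_topology (UNIV :: bool set)"
proof -
  let ?X = "hom_cycle_path m n" and ?D = "discrete_topology (UNIV :: bool set)"
  let ?f = "\<lambda>p. odd_mass n p > 1/2"
  let ?h = "\<lambda>(t, p). raise m n (3 + t * (real n - 2)) p"
  have n2: "n \<ge> 2" using assms by simp
  have f: "?f p = e" if "p \<in> topspace ?X" "has_parity m e p" for p e
    using odd_mass_eq[OF assms(1) that] by auto
  \<comment> \<open>\<open>odd_mass\<close> takes only the values 0 and 1 on the complex, so cutting
    at 1/2 from both sides yields complementary open sets.\<close>
  have "openin ?X {p \<in> topspace ?X. odd_mass n p \<in> {1/2<..}}" "openin ?X {p \<in> topspace ?X. odd_mass n p \<in> {..<1/2}}"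
    by (rule openin_continuous_map_preimage[OF continuous_map_odd_mass[OF assms(1)]]; simp)+
  moreover have not_f: "{p \<in> topspace ?X. \<not> ?f p} = {p \<in> topspace ?X. odd_mass n p < 1/2}"
    using has_parity_exists[OF assms(1)] odd_mass_eq[OF assms(1)] by (fastforce simp: of_bool_def)
  ultimately have op: "openin ?X {p \<in> topspace ?X. ?f p}" "openin ?X {p \<in> topspace ?X. \<not> ?f p}"
    by (simp_all add: not_f)
  have cf: "continuous_map ?X ?D ?f"
  proof -
    have "openin ?X {p \<in> topspace ?X. ?f p \<in> U}" for U
    proof -
      have "{p \<in> topspace ?X. ?f p \<in> U} =
        (if True \<in> U then {p \<in> topspace ?X. ?f p} else {}) \<union>
        (if False \<in> U then {p \<in> topspace ?X. \<not> ?f p} else {})"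
        by (auto split: if_splits) (metis (full_types))+
      then show ?thesis using op by auto
    qed
    then show ?thesis by (auto simp: continuous_map_def)
  qed
  have cg: "continuous_map ?D ?X (bottom m)"
    using bottom_in_hom_cycle_path[OF n2] by auto
  have "homotopic_with (\<lambda>h. True) ?X ?X (bottom m \<circ> ?f) id"
  proof (subst homotopic_with)
    \<comment> \<open>The deformation starts at the bottom vertex of the part containing
      \<open>p\<close> and ends at \<open>p\<close>.\<close>
    have "raise m n 3 p = bottom m (?f p) \<and> raise m n (real n + 1) p = p" if "p \<in> topspace ?X" for p
    proof -
      obtain e where e: "has_parity m e p" using has_parity_exists assms(1) \<open>p \<in> topspace ?X\<close> by blast
      show ?thesis using raise_ends[OF assms(1) that e] f[OF that e] by simp
    qed
    then have "(\<forall>p\<in>topspace ?X. ?h (0, p) = (bottom m \<circ> ?f) p) \<and> (\<forall>p\<in>topspace ?X. ?h (1, p) = id p)"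
      by (simp add: add.commute)
    with continuous_map_raise[OF assms(1) n2]
    show "\<exists>h. continuous_map (prod_topology (top_of_set {0..1::real}) ?X) ?X h \<and>
        (\<forall>p\<in>topspace ?X. h (0, p) = (bottom m \<circ> ?f) p) \<and>
        (\<forall>p\<in>topspace ?X. h (1, p) = id p) \<and> (\<forall>t\<in>{0..1::real}. True)"
      by blast
  qed auto
  \<comment> \<open>This composite equals the identity, since \<open>bottom m e\<close> has parity
    \<open>e\<close>.\<close>
  moreover have "homotopic_with (\<lambda>h. True) ?D ?D (?f \<circ> bottom m) id"
    using f[OF bottom_in_hom_cycle_path[OF n2] has_parity_bottom]
    by (intro homotopic_with_equal continuous_map_compose[OF cg cf]) auto
  ultimately show ?thesis
    unfolding homotopy_equivalent_space_def using cf cg by blast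
qed

end
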